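(* Let $A=(A^s)_{s=1}^d$ be a left-canonical injective MPS tensor with bond dimension $\chi$, let $L\ge 1$, and let $U_1,\dots,U_L$ be unitary $d\times d$ matrices; put $\mathcal U=\bigotimes_{j=1}^L U_j$. Assume that for every positive integer $k$ the periodic MPS $|\psi_{kL}\rangle$ on $kL$ sites generated by $A$ is an eigenstate of $\mathcal U^{\otimes k}$ (the $k$-fold periodic extension of $\mathcal U$), i.e. $\mathcal U^{\otimes k}|\psi_{kL}\rangle=e^{i\theta_k}|\psi_{kL}\rangle$ for some $\theta_k\in\mathbb R$. Then there exist unitary $\chi\times\chi$ matrices $v_0,v_1,\dots,v_L$ with $v_0\doteq v_L$ such that for every $j=1,\dots,L$ $$U_j\cdot A\;\doteq\; v_{j-1}^\dagger\,A\,v_j ,$$ i.e. there are $\phi_j\in\mathbb R$ with $\sum_{s'}(U_j)_{ss'}A^{s'}=e^{i\phi_j}\,v_{j-1}^\dagger A^s v_j$ for all $s$.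
   Context: An MPS tensor is a tuple $A=(A^s)_{s=1}^d$ of complex $\chi\times\chi$ matrices ($d$ = physical dimension, $\chi$ = bond dimension). The periodic translation-invariant MPS on $M$ sites is $|\psi_M\rangle=\sum_{s_1,\dots,s_M}\mathrm{Tr}(A^{s_1}\cdots A^{s_M})|s_1\dots s_M\rangle\in(\mathbb C^d)^{\otimes M}$. The transfer channel is $\mathcal E(X)=\sum_s (A^s)^\dagger X A^s$. Left-canonical injective means: $\mathcal E(\mathbb 1)=\mathbb 1$; there is a positive definite (full-rank) $\rho$ with $\mathrm{Tr}\,\rho=1$ and $\sum_s A^s\rho (A^s)^\dagger=\rho$; and $1$ is a simple eigenvalue of $\mathcal E$ with all other eigenvalues of modulus strictly less than $1$. For a $d\times d$ matrix $U$, $(U\cdot A)^s=\sum_{s'}U_{ss'}A^{s'}$. The symbol $\doteq$ denotes equality up to a phase (a complex number of modulus one, the same for all values of the physical index $s$). *)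

theory Defs
  imports "HOL-Analysis.Analysis"
begin

subsection \<open>Complex matrices\<close>

definition cscale :: "complex \<Rightarrow> complex^'n^'m \<Rightarrow> complex^'n^'m" (infixr "*\<^sub>C" 75)
  where "c *\<^sub>C X = (\<chi> i j. c * X $ i $ j)"

lemma vector_space_cscale: "vector_space (cscale :: complex \<Rightarrow> complex^'n^'m \<Rightarrow> complex^'n^'m)"
  by unfold_locales (auto simp: cscale_def vec_eq_iff algebra_simps)

definition cadjoint :: "complex^'n^'m \<Rightarrow> complex^'m^'n" ("_\<^sup>\<dagger>" [1000] 999)
  where "X\<^sup>\<dagger> = (\<chi> i j. cnj (X $ j $ i))"

definition unitary :: "complex^'n^'n \<Rightarrow> bool"
  where "unitary V \<longleftrightarrow> V\<^sup>\<dagger> ** V = mat 1 \<and> V ** V\<^sup>\<dagger> = mat 1"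

definition positive_definite :: "complex^'n^'n \<Rightarrow> bool"
  where "positive_definite P \<longleftrightarrow>
    P\<^sup>\<dagger> = P \<and> (\<forall>x. x \<noteq> 0 \<longrightarrow> Re (\<Sum>i\<in>UNIV. \<Sum>j\<in>UNIV. cnj (x $ i) * P $ i $ j * x $ j) > 0)"

definition eq_upto_phase :: "complex^'n^'m \<Rightarrow> complex^'n^'m \<Rightarrow> bool" (infix "\<doteq>" 50)
  where "X \<doteq> Y \<longleftrightarrow> (\<exists>c. cmod c = 1 \<and> X = c *\<^sub>C Y)"

subsection \<open>Eigenvalues of linear maps on matrices\<close>

definition is_eigenvalue :: "(complex^'n^'n \<Rightarrow> complex^'n^'n) \<Rightarrow> complex \<Rightarrow> bool"
  where "is_eigenvalue T c \<longleftrightarrow> (\<exists>X. X \<noteq> 0 \<and> T X = c *\<^sub>C X)"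

definition generalized_eigenspace ::
    "(complex^'n^'n \<Rightarrow> complex^'n^'n) \<Rightarrow> complex \<Rightarrow> (complex^'n^'n) set"
  where "generalized_eigenspace T c = {X. \<exists>m. ((\<lambda>Y. T Y - c *\<^sub>C Y) ^^ m) X = 0}"

text \<open>Simple means algebraic multiplicity one, i.e. the generalized eigenspace has complex
  dimension one.\<close>

definition simple_eigenvalue :: "(complex^'n^'n \<Rightarrow> complex^'n^'n) \<Rightarrow> complex \<Rightarrow> bool"
  where "simple_eigenvalue T c \<longleftrightarrow> vector_space.dim cscale (generalized_eigenspace T c) = 1"

subsection \<open>MPS tensors\<close>

text \<open>The physical dimension is \<open>CARD('d)\<close> and the bond dimension is \<open>CARD('n)\<close>.\<close>

type_synonym ('d, 'n) mps_tensor = "'d \<Rightarrow> complex^'n^'n"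

definition transfer_channel :: "('d::finite, 'n::finite) mps_tensor \<Rightarrow> complex^'n^'n \<Rightarrow> complex^'n^'n"
  where "transfer_channel A X = (\<Sum>s\<in>UNIV. (A s)\<^sup>\<dagger> ** X ** A s)"

definition left_canonical_injective :: "('d::finite, 'n::finite) mps_tensor \<Rightarrow> bool"
  where "left_canonical_injective A \<longleftrightarrow>
    transfer_channel A (mat 1) = mat 1 \<and>
    (\<exists>\<rho>. positive_definite \<rho> \<and> trace \<rho> = 1 \<and> (\<Sum>s\<in>UNIV. A s ** \<rho> ** (A s)\<^sup>\<dagger>) = \<rho>) \<and>
    simple_eigenvalue (transfer_channel A) 1 \<and>
    (\<forall>c. is_eigenvalue (transfer_channel A) c \<and> c \<noteq> 1 \<longrightarrow> cmod c < 1)"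

definition act :: "complex^'d^'d \<Rightarrow> ('d::finite, 'n::finite) mps_tensor \<Rightarrow> ('d, 'n) mps_tensor"
  where "act U A = (\<lambda>s. \<Sum>s'\<in>UNIV. (U $ s $ s') *\<^sub>C A s')"

subsection \<open>States and operators on chains\<close>

text \<open>A vector of the \<open>M\<close>-fold tensor power of \<open>\<complex>\<^sup>d\<close> is given by its coefficients in the product
  basis, which is indexed by the lists of length \<open>M\<close> over \<open>'d\<close>; the coefficient function is 0 on
  lists of any other length.  An operator is given by its matrix elements in that basis.\<close>

type_synonym 'd state = "'d list \<Rightarrow> complex"
type_synonym 'd chain_op = "'d list \<Rightarrow> 'd list \<Rightarrow> complex"

definition mps :: "('d::finite, 'n::finite) mps_tensor \<Rightarrow> nat \<Rightarrow> 'd state"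
  where "mps A M = (\<lambda>s. if length s = M then trace (foldr (**) (map A s) (mat 1)) else 0)"

definition apply_op :: "nat \<Rightarrow> 'd::finite chain_op \<Rightarrow> 'd state \<Rightarrow> 'd state"
  where "apply_op M K \<psi> = (\<lambda>s. if length s = M then (\<Sum>t | length t = M. K s t * \<psi> t) else 0)"

text \<open>The tensor product of \<open>U 1, \<dots>, U L\<close>; list positions are counted from 0.\<close>

definition site_tensor :: "(nat \<Rightarrow> complex^'d^'d) \<Rightarrow> nat \<Rightarrow> 'd chain_op"
  where "site_tensor U L = (\<lambda>s t. \<Prod>j<L. U (Suc j) $ (s ! j) $ (t ! j))"

text \<open>The \<open>k\<close>-fold tensor power of an operator on \<open>L\<close> sites, acting on consecutive blocks.\<close>

definition tensor_power :: "nat \<Rightarrow> 'd chain_op \<Rightarrow> nat \<Rightarrow> 'd chain_op"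
  where "tensor_power L K k =
    (\<lambda>s t. \<Prod>b<k. K (take L (drop (b * L) s)) (take L (drop (b * L) t)))"

end

theory Submission
  imports Defs "HOL-Computational_Algebra.Fundamental_Theorem_Algebra"
begin

text \<open>For a tensor \<open>A\<close> and \<open>B\<^sub>j = U\<^sub>j \<cdot> A\<close>, the overlap of \<open>\<psi>\<^bsub>kL\<^esub>\<close> with its image is the trace of the \<open>k\<close>-th
  power of \<open>F = E\<^sub>L \<circ> \<dots> \<circ> E\<^sub>1\<close>, where \<open>E\<^sub>j(X) = \<Sum>\<^sub>s (A\<^sup>s)\<^sup>\<dagger> X B\<^sub>j\<^sup>s\<close>.  Its modulus equals the squared norm
  of \<open>\<psi>\<^bsub>kL\<^esub>\<close>, which tends to 1, so \<open>F\<close> has an eigenvalue of modulus at least 1.  Each \<open>E\<^sub>j\<close> is a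
  contraction in the norm weighted by \<open>\<rho>\<close>, with equality only if \<open>X B\<^sub>j\<^sup>s = A\<^sup>s E\<^sub>j(X)\<close> for all \<open>s\<close>.  Hence
  the eigenvector \<open>X\<^sub>0\<close> and its images \<open>X\<^sub>j = E\<^sub>j(X\<^bsub>j-1\<^esub>)\<close> satisfy \<open>X\<^bsub>j-1\<^esub> B\<^sub>j\<^sup>s = A\<^sup>s X\<^sub>j\<close>.  The transfer
  channel then sends \<open>X\<^bsub>j-1\<^esub>\<^sup>\<dagger> X\<^bsub>j-1\<^esub>\<close> to \<open>X\<^sub>j\<^sup>\<dagger> X\<^sub>j\<close> and returns to the start after \<open>L\<close> steps, so by
  the spectral gap all of these are one multiple of the identity, and the \<open>X\<^sub>j\<close> rescale to unitaries.\<close>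

subsection \<open>Complex matrix algebra\<close>

lemma cscale_nth [simp]: "(c *\<^sub>C X) $ i $ j = c * X $ i $ j"
  by (simp add: cscale_def)

lemma cadjoint_nth [simp]: "X\<^sup>\<dagger> $ i $ j = cnj (X $ j $ i)"
  by (simp add: cadjoint_def)

lemma cscale_one [simp]: "1 *\<^sub>C X = X"
  and cscale_zero_left [simp]: "0 *\<^sub>C X = 0"
  and cscale_zero_right [simp]: "c *\<^sub>C 0 = 0"
  and cscale_cscale [simp]: "a *\<^sub>C b *\<^sub>C X = (a * b) *\<^sub>C X"
  and cscale_add_right: "c *\<^sub>C (X + Y) = c *\<^sub>C X + c *\<^sub>C Y"
  and cscale_diff_right: "c *\<^sub>C (X - Y) = c *\<^sub>C X - c *\<^sub>C Y"
  and cscale_diff_left: "(a - b) *\<^sub>C X = a *\<^sub>C X - b *\<^sub>C X"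
  and scaleR_conv_cscale: "r *\<^sub>R X = complex_of_real r *\<^sub>C X"
  and cscale_minus_left: "(- a) *\<^sub>C X = - (a *\<^sub>C X)"
  for X Y :: "complex^'n^'m"
  by (simp_all add: vec_eq_iff algebra_simps scaleR_conv_of_real[where 'a = complex])

lemma cscale_sum_right: "c *\<^sub>C sum f S = (\<Sum>s\<in>S. c *\<^sub>C f s)"
  by (induction S rule: infinite_finite_induct) (auto simp: cscale_add_right)

lemma cscale_eq_0_iff: "c *\<^sub>C X = 0 \<longleftrightarrow> c = 0 \<or> X = 0"
  by (auto simp: vec_eq_iff)

lemma norm_cscale [simp]: "norm (c *\<^sub>C X) = cmod c * norm X"
proof -
  have "norm ((c *\<^sub>C X) $ i) = cmod c * norm (X $ i)" for i
    by (simp add: norm_vec_def norm_mult L2_set_right_distrib)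
  then show ?thesis
    by (simp add: norm_vec_def[of "c *\<^sub>C X"] norm_vec_def[of X] L2_set_right_distrib)
qed

lemma cadjoint_cadjoint [simp]: "(X\<^sup>\<dagger>)\<^sup>\<dagger> = X"
  and cadjoint_mat_1 [simp]: "(mat 1 :: complex^'m^'m)\<^sup>\<dagger> = mat 1"
  and cadjoint_diff: "(X - Y)\<^sup>\<dagger> = X\<^sup>\<dagger> - Y\<^sup>\<dagger>"
  and cadjoint_cscale: "(c *\<^sub>C X)\<^sup>\<dagger> = cnj c *\<^sub>C X\<^sup>\<dagger>"
  for X Y :: "complex^'n^'m"
  by (auto simp: vec_eq_iff mat_def)

lemma cadjoint_mult: "(X ** Y)\<^sup>\<dagger> = Y\<^sup>\<dagger> ** X\<^sup>\<dagger>"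
  by (simp add: vec_eq_iff matrix_matrix_mult_def mult.commute)

lemma cadjoint_sum: "(sum f S)\<^sup>\<dagger> = (\<Sum>s\<in>S. (f s)\<^sup>\<dagger>)"
  by (simp add: vec_eq_iff)

lemma matrix_mult_cscale_left: "(c *\<^sub>C X) ** Y = c *\<^sub>C (X ** Y)"
  and matrix_mult_cscale_right: "X ** (c *\<^sub>C Y) = c *\<^sub>C (X ** Y)"
  for X :: "complex^'n^'m" and Y :: "complex^'k^'n"
  by (simp_all add: vec_eq_iff matrix_matrix_mult_def sum_distrib_left algebra_simps)

lemma matrix_mult_add_left: "(X + Y) ** Z = X ** Z + Y ** Z"
  and matrix_mult_diff_left: "(X - Y) ** Z = X ** Z - Y ** Z"
  and matrix_mult_diff_right: "W ** (X - Y) = W ** X - W ** Y"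
  for X Y :: "complex^'n^'m"
  by (simp_all add: vec_eq_iff matrix_matrix_mult_def algebra_simps sum_subtractf sum.distrib)

lemma matrix_mult_sum_left: "sum f S ** Z = (\<Sum>s\<in>S. f s ** Z)"
  for Z :: "complex^'n^'m"
  by (induction S rule: infinite_finite_induct) (simp_all add: matrix_mult_add_left)

lemma matrix_mult_sum_right: "Z ** sum f S = (\<Sum>s\<in>S. Z ** f s)"
  for Z :: "complex^'n^'m"
  by (induction S rule: infinite_finite_induct) (simp_all add: matrix_add_ldistrib)

lemma trace_sum: "trace (sum f S) = (\<Sum>s\<in>S. trace (f s))"
  for f :: "_ \<Rightarrow> complex^'n^'n"
  by (simp add: trace_def) (subst sum.swap, simp)

lemma trace_cscale: "trace (c *\<^sub>C X) = c * trace X"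
  by (simp add: trace_def sum_distrib_left)

subsection \<open>Powers of linear maps on matrices\<close>

abbreviation clinear :: "(complex^'n^'m \<Rightarrow> complex^'l^'k) \<Rightarrow> bool"
  where "clinear \<equiv> Vector_Spaces.linear cscale cscale"

lemma clinearI:
  assumes "\<And>X Y. T (X + Y) = T X + T Y" and "\<And>c X. T (c *\<^sub>C X) = c *\<^sub>C T X"
  shows "clinear T"
  using assms by (simp add: Vector_Spaces.linear_iff vector_space_cscale)

lemma
  assumes "clinear T"
  shows clinear_add: "T (X + Y) = T X + T Y"
    and clinear_cscale: "T (c *\<^sub>C X) = c *\<^sub>C T X"
  using assms by (simp_all add: Vector_Spaces.linear_iff)

lemma clinear_0: "clinear T \<Longrightarrow> T 0 = 0"
  using clinear_cscale[of T 0 0] by simp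

lemma clinear_diff:
  assumes "clinear T" shows "T (X - Y) = T X - T Y"
  using clinear_add[OF assms, of "X - Y" Y] by simp

lemma clinear_sum: "clinear T \<Longrightarrow> T (sum f S) = (\<Sum>s\<in>S. T (f s))"
  by (induction S rule: infinite_finite_induct) (simp_all add: clinear_add clinear_0)

lemma clinear_funpow:
  fixes T :: "complex^'n^'m \<Rightarrow> complex^'n^'m"
  assumes "clinear T" shows "clinear (T ^^ k)"
proof (induction k)
  case (Suc k)
  show ?case
    using clinear_add[OF Suc] clinear_cscale[OF Suc] clinear_add[OF assms] clinear_cscale[OF assms]
    by (intro clinearI) auto
qed (simp add: clinearI)

lemma scaled_recurrence_tendsto_0:
  fixes a b :: "nat \<Rightarrow> complex^'n^'m"
  assumes rec: "\<And>k. a (Suc k) = c *\<^sub>C a k + b k" and c: "cmod c < 1" and b: "b \<longlonglongrightarrow> 0"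
  shows "a \<longlonglongrightarrow> 0"
proof (rule LIMSEQ_I)
  fix e :: real assume e: "0 < e"
  \<comment> \<open>The value is chosen so that \<open>e / 2\<close> is the fixed point of the map
    sending \<open>t\<close> to \<open>cmod c * t + d\<close>; this makes the bound below
    inductive.\<close>
  define d where "d = e / 2 * (1 - cmod c)"
  have "d > 0" using e c by (simp add: d_def)
  then obtain N where N: "\<And>k. k \<ge> N \<Longrightarrow> norm (b k) < d"
    using LIMSEQ_D[OF b] by auto
  have bound: "norm (a (N + m)) \<le> cmod c ^ m * norm (a N) + e / 2" for m
  proof (induction m)
    case (Suc m)
    have "norm (a (N + Suc m)) \<le> cmod c * norm (a (N + m)) + norm (b (N + m))"
      using norm_triangle_ineq[of "c *\<^sub>C a (N + m)" "b (N + m)"] by (simp add: rec)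
    also have "\<dots> \<le> cmod c * (cmod c ^ m * norm (a N) + e / 2) + d"
      using N[of "N + m"] Suc by (intro add_mono mult_left_mono) auto
    finally show ?case
      by (simp add: d_def field_simps)
  qed (use e in simp)
  have "(\<lambda>m. cmod c ^ m * norm (a N)) \<longlonglongrightarrow> 0 * norm (a N)"
    using c by (intro tendsto_mult LIMSEQ_realpow_zero) auto
  then obtain M where M: "\<And>m. m \<ge> M \<Longrightarrow> cmod c ^ m * norm (a N) < e / 2"
    using LIMSEQ_D[of _ 0 "e / 2"] e by fastforce
  show "\<exists>no. \<forall>n\<ge>no. norm (a n - 0) < e"
  proof (intro exI allI impI)
    fix n assume "n \<ge> N + M"
    then show "norm (a n - 0) < e"
      using bound[of "n - N"] M[of "n - N"] by force
  qed
qed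

text \<open>\<open>N + 1\<close> matrices in a space of real dimension \<open>N\<close> are linearly
  dependent, and the relation is read as a polynomial. When \<open>f\<close> is an orbit
  \<open>(T ^^ i) X\<close>, this says that \<open>p\<close> evaluated at \<open>T\<close> kills
  \<open>X\<close>.\<close>

lemma annihilating_poly_exists:
  fixes f :: "nat \<Rightarrow> complex^'n^'m"
  obtains p :: "complex poly" and N
  where "p \<noteq> 0" "degree p \<le> N" "(\<Sum>i\<le>N. coeff p i *\<^sub>C f i) = 0"
proof -
  define N where "N = DIM(complex^'n^'m)"
  have "\<exists>c. (\<exists>i\<le>N. c i \<noteq> 0) \<and> (\<Sum>i\<le>N. c i *\<^sub>C f i) = 0"
  proof (cases "inj_on f {..N}")
    case True
    then have "dependent (f ` {..N})"
      by (intro dependent_biggerset) (simp add: card_image N_def)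
    then obtain u where u: "\<exists>v\<in>f ` {..N}. u v \<noteq> 0" "(\<Sum>v\<in>f ` {..N}. u v *\<^sub>R v) = 0"
      by (auto simp: real_vector.dependent_finite)
    then have "(\<Sum>i\<le>N. of_real (u (f i)) *\<^sub>C f i) = 0"
      using True by (simp add: sum.reindex scaleR_conv_cscale)
    then show ?thesis
      using u(1) by (intro exI[of _ "\<lambda>i. of_real (u (f i))"]) auto
  next
    case False
    \<comment> \<open>\<open>dependent\<close> speaks of the set of values and misses repetitions;
      two equal members give a relation with coefficients 1 and -1.\<close>
    then obtain i j where ij: "i \<le> N" "j \<le> N" "i \<noteq> j" "f i = f j"
      by (auto simp: inj_on_def)
    have "(\<Sum>k\<le>N. ((if k = i then 1 else 0) - (if k = j then 1 else 0)) *\<^sub>C f k) = f i - f j"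
      using ij by (simp add: cscale_diff_left sum_subtractf if_distrib[of "\<lambda>c. c *\<^sub>C _"] cong: if_cong)
    then show ?thesis
      using ij by (intro exI[of _ "\<lambda>k. (if k = i then 1 else 0) - (if k = j then 1 else 0)"]) auto
  qed
  then obtain c where c: "\<exists>i\<le>N. c i \<noteq> 0" "(\<Sum>i\<le>N. c i *\<^sub>C f i) = 0"
    by blast
  define p where "p = (\<Sum>i\<le>N. monom (c i) i)"
  have coeff: "coeff p i = (if i \<le> N then c i else 0)" for i
    by (simp add: p_def coeff_sum)
  show thesis
  proof
    show "p \<noteq> 0" using c(1) coeff by (metis coeff_0)
    show "degree p \<le> N" by (rule degree_le) (simp add: coeff)
    show "(\<Sum>i\<le>N. coeff p i *\<^sub>C f i) = 0" using c(2) by (simp add: coeff)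
  qed
qed

text \<open>Induction on an annihilating polynomial of \<open>X\<close>: a linear factor whose root has modulus
  at least 1 can be cancelled because \<open>T - a\<close> is injective; one whose root has modulus below 1
  turns the powers of \<open>T\<close> into a contracting recurrence.\<close>

lemma funpow_tendsto_0_of_annihilator:
  fixes T :: "complex^'n^'n \<Rightarrow> complex^'n^'n"
  assumes T: "clinear T" and ev: "\<And>c. is_eigenvalue T c \<Longrightarrow> cmod c < 1"
  shows "p \<noteq> 0 \<Longrightarrow> degree p \<le> N \<Longrightarrow> (\<Sum>i\<le>N. coeff p i *\<^sub>C (T ^^ i) X) = 0
    \<Longrightarrow> (\<lambda>k. (T ^^ k) X) \<longlonglongrightarrow> 0"
proof (induction N arbitrary: p X)
  case 0
  then have "X = 0"
    using leading_coeff_0_iff[of p] by (auto simp: cscale_eq_0_iff)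
  then show ?case
    by (simp add: clinear_0[OF clinear_funpow[OF T]])
next
  case (Suc N)
  show ?case
  proof (cases "degree p = 0")
    case True
    then show ?thesis using Suc.IH[of p X] Suc.prems
      by (simp add: coeff_eq_0)
  next
    case False
    then obtain a where "poly p a = 0"
      using fundamental_theorem_of_algebra_alt[of p] by force
    then obtain q where pq: "p = [:- a, 1:] * q"
      by (metis dvdE poly_eq_0_iff_dvd)
    have q: "q \<noteq> 0" using Suc.prems pq by auto
    have deg: "degree q \<le> N"
      using Suc.prems(2) q unfolding pq by (subst (asm) degree_mult_eq) auto
    \<comment> \<open>\<open>Q\<close> is \<open>q\<close> evaluated at \<open>T\<close>. It
      commutes with \<open>T\<close>, and the factorization of \<open>p\<close> says that
      \<open>T - a\<close> kills \<open>Q X\<close>.\<close>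
    define Q where "Q Z = (\<Sum>i\<le>N. coeff q i *\<^sub>C (T ^^ i) Z)" for Z
    have coeff_Suc: "coeff p (Suc i) = coeff q i - a * coeff q (Suc i)" for i
      by (simp add: pq)
    have coeff_0: "coeff p 0 = - a * coeff q 0"
      by (simp add: pq)
    have shift: "T (Q Z) = (\<Sum>i\<le>N. coeff q i *\<^sub>C (T ^^ Suc i) Z)" for Z
      by (simp add: Q_def clinear_sum[OF T] clinear_cscale[OF T])
    have swap: "(T ^^ i) (T Z) = T ((T ^^ i) Z)" for i Z
      by (rule funpow_swap1[symmetric])
    have Qsub: "Q (T X - a *\<^sub>C X) = T (Q X) - a *\<^sub>C Q X"
      unfolding shift
      by (simp add: Q_def clinear_diff[OF clinear_funpow[OF T]] clinear_cscale[OF clinear_funpow[OF T]]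
          swap cscale_diff_right sum_subtractf cscale_sum_right mult.commute)
    have "(\<Sum>i\<le>Suc N. coeff q i *\<^sub>C (T ^^ i) X) = Q X"
      using deg by (simp add: Q_def coeff_eq_0)
    then have Qexp: "Q X = coeff q 0 *\<^sub>C X + (\<Sum>i\<le>N. coeff q (Suc i) *\<^sub>C (T ^^ Suc i) X)"
      by (subst (asm) sum.atMost_Suc_shift) simp
    have "(\<Sum>i\<le>Suc N. coeff p i *\<^sub>C (T ^^ i) X)
      = coeff p 0 *\<^sub>C X + (\<Sum>i\<le>N. coeff p (Suc i) *\<^sub>C (T ^^ Suc i) X)"
      by (subst sum.atMost_Suc_shift) simp
    also have "\<dots> = T (Q X) - a *\<^sub>C Q X"
      unfolding shift unfolding Qexp
      by (simp add: coeff_Suc coeff_0 cscale_diff_left sum_subtractf cscale_add_right cscale_sum_right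
          cscale_minus_left)
    finally have fact: "T (Q X) - a *\<^sub>C Q X = 0"
      using Suc.prems(3) by simp
    show ?thesis
    proof (cases "cmod a < 1")
      case True
      \<comment> \<open>By commutation \<open>q\<close> annihilates
        \<open>T X - a *\<^sub>C X\<close>, whose orbit therefore tends to 0 and serves as the error
        term of a recurrence with ratio \<open>a\<close>.\<close>
      have "(\<lambda>k. (T ^^ k) (T X - a *\<^sub>C X)) \<longlonglongrightarrow> 0"
        using Suc.IH[OF q deg] fact Qsub by (simp add: Q_def)
      then show ?thesis
      proof (rule scaled_recurrence_tendsto_0[rotated 2])
        show "(T ^^ Suc k) X = a *\<^sub>C (T ^^ k) X + (T ^^ k) (T X - a *\<^sub>C X)" for k
          by (simp add: clinear_diff[OF clinear_funpow[OF T]] clinear_cscale[OF clinear_funpow[OF T]]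
              swap)
      qed (rule True)
    next
      case False
      then have "Q X = 0"
        using ev[of a] fact by (auto simp: is_eigenvalue_def)
      then show ?thesis
        using Suc.IH[OF q deg] by (simp add: Q_def)
    qed
  qed
qed

text \<open>Finite dimension gives each orbit its own annihilating polynomial, so decay is proved
  orbit by orbit.\<close>

lemma funpow_tendsto_0:
  fixes T :: "complex^'n^'n \<Rightarrow> complex^'n^'n"
  assumes "clinear T" and "\<And>c. is_eigenvalue T c \<Longrightarrow> cmod c < 1"
  shows "(\<lambda>k. (T ^^ k) X) \<longlonglongrightarrow> 0"
proof -
  obtain p N where "p \<noteq> 0" "degree p \<le> N" "(\<Sum>i\<le>N. coeff p i *\<^sub>C (T ^^ i) X) = 0"
    by (rule annihilating_poly_exists)
  then show ?thesis
    using funpow_tendsto_0_of_annihilator[OF assms] by blast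
qed

subsection \<open>Mixed transfer maps\<close>

definition mixed_channel ::
    "('d::finite \<Rightarrow> complex^'n^'m) \<Rightarrow> ('d \<Rightarrow> complex^'l^'k) \<Rightarrow> complex^'k^'m \<Rightarrow> complex^'l^'n"
  where "mixed_channel A B X = (\<Sum>s\<in>UNIV. (A s)\<^sup>\<dagger> ** X ** B s)"

lemma transfer_channel_eq_mixed: "transfer_channel A = mixed_channel A A"
  by (simp add: fun_eq_iff transfer_channel_def mixed_channel_def)

lemma clinear_mixed_channel: "clinear (mixed_channel A B)"
  by (rule clinearI) (simp_all add: mixed_channel_def matrix_add_ldistrib matrix_mult_add_left
      sum.distrib matrix_mult_cscale_left matrix_mult_cscale_right cscale_sum_right)

lemma cadjoint_mixed_channel: "(mixed_channel A B X)\<^sup>\<dagger> = mixed_channel B A (X\<^sup>\<dagger>)"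
  by (simp add: mixed_channel_def cadjoint_sum cadjoint_mult matrix_mul_assoc)

lemma unitary_column_orthonormal:
  assumes "unitary U"
  shows "(\<Sum>s\<in>UNIV. cnj (U $ s $ a) * U $ s $ b) = (if a = b then 1 else 0)"
proof -
  have "(U\<^sup>\<dagger> ** U) $ a $ b = mat 1 $ a $ b"
    using assms by (simp add: unitary_def)
  then show ?thesis
    by (simp add: matrix_matrix_mult_def mat_def)
qed

text \<open>For fixed bond indices the entries of \<open>A\<close> form a vector over the physical
  index. \<open>act U\<close> applies \<open>U\<close> to it, and the sum is an inner product of two
  such vectors.\<close>

lemma sum_act_unitary:
  assumes "unitary U"
  shows "(\<Sum>s\<in>UNIV. cnj (act U A s $ i $ j) * act U A s $ k $ l)
    = (\<Sum>s\<in>UNIV. cnj (A s $ i $ j) * A s $ k $ l)"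
proof -
  have "(\<Sum>s\<in>UNIV. cnj (act U A s $ i $ j) * act U A s $ k $ l)
    = (\<Sum>s\<in>UNIV. \<Sum>a\<in>UNIV. \<Sum>b\<in>UNIV.
        (cnj (U $ s $ a) * U $ s $ b) * (cnj (A a $ i $ j) * A b $ k $ l))"
    by (simp add: act_def sum_product) (simp add: mult_ac)
  also have "\<dots> = (\<Sum>a\<in>UNIV. \<Sum>b\<in>UNIV. \<Sum>s\<in>UNIV.
        (cnj (U $ s $ a) * U $ s $ b) * (cnj (A a $ i $ j) * A b $ k $ l))"
    by (subst sum.swap, rule sum.cong[OF refl], subst sum.swap, rule refl)
  also have "\<dots> = (\<Sum>a\<in>UNIV. \<Sum>b\<in>UNIV.
        (if a = b then 1 else 0) * (cnj (A a $ i $ j) * A b $ k $ l))"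
    by (simp only: sum_distrib_right[symmetric] unitary_column_orthonormal[OF assms])
  also have "\<dots> = (\<Sum>a\<in>UNIV. \<Sum>b\<in>UNIV. if a = b then cnj (A a $ i $ j) * A b $ k $ l else 0)"
    by (intro sum.cong refl) auto
  finally show ?thesis
    by simp
qed

text \<open>Each entry of the channel depends on the tensor only through the inner products of
  \<open>sum_act_unitary\<close>.\<close>

lemma mixed_channel_act:
  assumes "unitary U"
  shows "mixed_channel (act U A) (act U A) = mixed_channel A A"
proof -
  have entry: "mixed_channel B B X $ i $ j
    = (\<Sum>l\<in>UNIV. \<Sum>k\<in>UNIV. X $ k $ l * (\<Sum>s\<in>UNIV. cnj (B s $ k $ i) * B s $ l $ j))"
    for B :: "'a \<Rightarrow> complex^'b^'b" and X i j
  proof -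
    have "mixed_channel B B X $ i $ j
      = (\<Sum>s\<in>UNIV. \<Sum>l\<in>UNIV. \<Sum>k\<in>UNIV. X $ k $ l * (cnj (B s $ k $ i) * B s $ l $ j))"
      by (simp add: mixed_channel_def matrix_matrix_mult_def sum_distrib_right) (simp add: mult_ac)
    also have "\<dots> = (\<Sum>l\<in>UNIV. \<Sum>k\<in>UNIV. \<Sum>s\<in>UNIV. X $ k $ l * (cnj (B s $ k $ i) * B s $ l $ j))"
      by (subst sum.swap, rule sum.cong[OF refl], subst sum.swap, rule refl)
    finally show ?thesis
      by (simp only: sum_distrib_left)
  qed
  show ?thesis
    by (simp add: fun_eq_iff vec_eq_iff entry sum_act_unitary[OF assms])
qed

text \<open>The dual map depends on the same inner products; hence \<rho> remains a fixed point for
  the transformed tensor.\<close>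

lemma sum_act_conjugate:
  assumes "unitary U"
  shows "(\<Sum>s\<in>UNIV. act U A s ** X ** (act U A s)\<^sup>\<dagger>) = (\<Sum>s\<in>UNIV. A s ** X ** (A s)\<^sup>\<dagger>)"
proof -
  have entry: "(\<Sum>s\<in>UNIV. B s ** X ** (B s)\<^sup>\<dagger>) $ i $ j
    = (\<Sum>l\<in>UNIV. \<Sum>k\<in>UNIV. X $ k $ l * (\<Sum>s\<in>UNIV. cnj (B s $ j $ l) * B s $ i $ k))"
    for B :: "'a \<Rightarrow> complex^'b^'b" and X i j
  proof -
    have "(\<Sum>s\<in>UNIV. B s ** X ** (B s)\<^sup>\<dagger>) $ i $ j
      = (\<Sum>s\<in>UNIV. \<Sum>l\<in>UNIV. \<Sum>k\<in>UNIV. X $ k $ l * (cnj (B s $ j $ l) * B s $ i $ k))"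
      by (simp add: matrix_matrix_mult_def sum_distrib_right) (simp add: mult_ac)
    also have "\<dots> = (\<Sum>l\<in>UNIV. \<Sum>k\<in>UNIV. \<Sum>s\<in>UNIV. X $ k $ l * (cnj (B s $ j $ l) * B s $ i $ k))"
      by (subst sum.swap, rule sum.cong[OF refl], subst sum.swap, rule refl)
    finally show ?thesis
      by (simp only: sum_distrib_left)
  qed
  show ?thesis
    by (simp only: vec_eq_iff entry sum_act_unitary[OF assms]) simp
qed

subsection \<open>Contraction of the weighted norm\<close>

text \<open>The trace is the sum, over the rows of \<open>X\<close>, of the quadratic form of \<rho>
  at the conjugated row.\<close>

lemma positive_definite_trace:
  assumes "positive_definite \<rho>"
  shows "Re (trace (X ** \<rho> ** X\<^sup>\<dagger>)) \<ge> 0"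
    and "Re (trace (X ** \<rho> ** X\<^sup>\<dagger>)) = 0 \<Longrightarrow> X = 0"
proof -
  define x where "x k = (\<chi> i. cnj (X $ k $ i))" for k
  define q where "q y = Re (\<Sum>i\<in>UNIV. \<Sum>j\<in>UNIV. cnj (y $ i) * \<rho> $ i $ j * y $ j)" for y
  have q_pos: "y \<noteq> 0 \<Longrightarrow> q y > 0" for y
    using assms by (simp add: positive_definite_def q_def)
  then have q_nonneg: "q y \<ge> 0" for y
    by (cases "y = 0") (auto simp: q_def intro: less_imp_le)
  have "trace (X ** \<rho> ** X\<^sup>\<dagger>) = (\<Sum>k\<in>UNIV. \<Sum>i\<in>UNIV. \<Sum>j\<in>UNIV. cnj (x k $ i) * \<rho> $ i $ j * x k $ j)"
    unfolding trace_def matrix_matrix_mult_def x_def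
    by (intro sum.cong refl) (simp add: sum_distrib_right, rule sum.swap)
  then have eq: "Re (trace (X ** \<rho> ** X\<^sup>\<dagger>)) = (\<Sum>k\<in>UNIV. q (x k))"
    by (simp add: q_def)
  show "Re (trace (X ** \<rho> ** X\<^sup>\<dagger>)) \<ge> 0"
    unfolding eq by (intro sum_nonneg q_nonneg)
  assume "Re (trace (X ** \<rho> ** X\<^sup>\<dagger>)) = 0"
  then have "q (x k) = 0" for k
    unfolding eq by (simp add: sum_nonneg_eq_0_iff q_nonneg)
  then have "x k = 0" for k
    using q_pos[of "x k"] by force
  then show "X = 0"
    by (simp add: vec_eq_iff x_def)
qed

text \<open>Pythagoras: in the inner product \<open>trace (Y \<rho> X\<^sup>\<dagger>)\<close>, stacking the matrices \<open>X B\<^sup>s\<close> preserves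
  the norm, and \<open>A\<^sup>s\<close> applied to the mixed channel is the projection of the result onto the
  range of the isometry \<open>A\<close>.\<close>

lemma mixed_channel_defect:
  fixes A :: "'d::finite \<Rightarrow> complex^'n^'m" and B :: "'d \<Rightarrow> complex^'k^'k" and X :: "complex^'k^'m"
  assumes A: "(\<Sum>s\<in>UNIV. (A s)\<^sup>\<dagger> ** A s) = mat 1" and B: "(\<Sum>s\<in>UNIV. B s ** \<rho> ** (B s)\<^sup>\<dagger>) = \<rho>"
  defines "E \<equiv> mixed_channel A B X"
  shows "(\<Sum>s\<in>UNIV. trace ((X ** B s - A s ** E) ** \<rho> ** (X ** B s - A s ** E)\<^sup>\<dagger>))
    = trace (X ** \<rho> ** X\<^sup>\<dagger>) - trace (E ** \<rho> ** E\<^sup>\<dagger>)"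
proof -
  \<comment> \<open>\<open>t1\<close> to \<open>t4\<close> evaluate the terms of the expanded
    square: \<open>t1\<close> by the fixed point \<rho>, \<open>t2\<close> and \<open>t3\<close> by
    cyclicity and the definition of \<open>E\<close>, \<open>t4\<close> by the isometry
    condition.\<close>
  have t1: "(\<Sum>s\<in>UNIV. trace (X ** B s ** \<rho> ** (B s)\<^sup>\<dagger> ** X\<^sup>\<dagger>)) = trace (X ** \<rho> ** X\<^sup>\<dagger>)"
    by (subst (2) B[symmetric])
      (simp add: matrix_mult_sum_left matrix_mult_sum_right trace_sum matrix_mul_assoc)
  have "(\<Sum>s\<in>UNIV. trace (X ** B s ** \<rho> ** E\<^sup>\<dagger> ** (A s)\<^sup>\<dagger>))
    = (\<Sum>s\<in>UNIV. trace ((A s)\<^sup>\<dagger> ** X ** B s ** \<rho> ** E\<^sup>\<dagger>))"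
    by (subst trace_mul_sym) (simp add: matrix_mul_assoc)
  also have "\<dots> = trace (E ** \<rho> ** E\<^sup>\<dagger>)"
    unfolding E_def mixed_channel_def by (simp add: matrix_mult_sum_left trace_sum)
  finally have t2: "(\<Sum>s\<in>UNIV. trace (X ** B s ** \<rho> ** E\<^sup>\<dagger> ** (A s)\<^sup>\<dagger>)) = trace (E ** \<rho> ** E\<^sup>\<dagger>)" .
  have "(\<Sum>s\<in>UNIV. trace (A s ** (E ** \<rho> ** (B s)\<^sup>\<dagger> ** X\<^sup>\<dagger>)))
    = (\<Sum>s\<in>UNIV. trace (E ** \<rho> ** ((B s)\<^sup>\<dagger> ** X\<^sup>\<dagger> ** A s)))"
    by (subst trace_mul_sym) (simp add: matrix_mul_assoc)
  also have "\<dots> = trace (E ** \<rho> ** E\<^sup>\<dagger>)"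
    unfolding E_def cadjoint_mixed_channel
    by (simp add: mixed_channel_def[of B A] matrix_mult_sum_right trace_sum)
  finally have t3: "(\<Sum>s\<in>UNIV. trace (A s ** E ** \<rho> ** (B s)\<^sup>\<dagger> ** X\<^sup>\<dagger>)) = trace (E ** \<rho> ** E\<^sup>\<dagger>)"
    by (simp add: matrix_mul_assoc)
  have "(\<Sum>s\<in>UNIV. trace (A s ** E ** \<rho> ** E\<^sup>\<dagger> ** (A s)\<^sup>\<dagger>))
    = trace ((\<Sum>s\<in>UNIV. (A s)\<^sup>\<dagger> ** A s) ** E ** \<rho> ** E\<^sup>\<dagger>)"
    by (subst trace_mul_sym) (simp add: matrix_mul_assoc matrix_mult_sum_left trace_sum)
  then have t4: "(\<Sum>s\<in>UNIV. trace (A s ** E ** \<rho> ** E\<^sup>\<dagger> ** (A s)\<^sup>\<dagger>)) = trace (E ** \<rho> ** E\<^sup>\<dagger>)"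
    by (simp add: A)
  show ?thesis
    by (simp add: cadjoint_diff cadjoint_mult matrix_mult_diff_left matrix_mult_diff_right
        matrix_mul_assoc trace_sub sum_subtractf t1 t2 t3 t4)
qed

text \<open>The defect is a sum of squared weighted norms. It is nonnegative, and since \<rho> is
  definite it vanishes only if every summand does.\<close>

lemma
  fixes A :: "'d::finite \<Rightarrow> complex^'n^'m" and B :: "'d \<Rightarrow> complex^'k^'k" and X :: "complex^'k^'m"
  assumes A: "(\<Sum>s\<in>UNIV. (A s)\<^sup>\<dagger> ** A s) = mat 1" and B: "(\<Sum>s\<in>UNIV. B s ** \<rho> ** (B s)\<^sup>\<dagger>) = \<rho>"
    and \<rho>: "positive_definite \<rho>"
  defines "E \<equiv> mixed_channel A B X"
  shows mixed_channel_contraction: "Re (trace (E ** \<rho> ** E\<^sup>\<dagger>)) \<le> Re (trace (X ** \<rho> ** X\<^sup>\<dagger>))"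
    and mixed_channel_contraction_eq:
      "Re (trace (E ** \<rho> ** E\<^sup>\<dagger>)) = Re (trace (X ** \<rho> ** X\<^sup>\<dagger>)) \<Longrightarrow> X ** B s = A s ** E"
proof -
  define D where "D s = X ** B s - A s ** E" for s
  have eq: "(\<Sum>s\<in>UNIV. Re (trace (D s ** \<rho> ** (D s)\<^sup>\<dagger>)))
    = Re (trace (X ** \<rho> ** X\<^sup>\<dagger>)) - Re (trace (E ** \<rho> ** E\<^sup>\<dagger>))"
    using arg_cong[OF mixed_channel_defect[OF A B, of X], of Re] by (simp add: D_def E_def)
  have nonneg: "Re (trace (D s ** \<rho> ** (D s)\<^sup>\<dagger>)) \<ge> 0" for s
    by (rule positive_definite_trace[OF \<rho>])
  show "Re (trace (E ** \<rho> ** E\<^sup>\<dagger>)) \<le> Re (trace (X ** \<rho> ** X\<^sup>\<dagger>))"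
    using eq sum_nonneg[of UNIV "\<lambda>s. Re (trace (D s ** \<rho> ** (D s)\<^sup>\<dagger>))"] nonneg by simp
  assume "Re (trace (E ** \<rho> ** E\<^sup>\<dagger>)) = Re (trace (X ** \<rho> ** X\<^sup>\<dagger>))"
  then have "Re (trace (D s ** \<rho> ** (D s)\<^sup>\<dagger>)) = 0"
    using eq nonneg by (simp add: sum_nonneg_eq_0_iff)
  then have "D s = 0"
    by (rule positive_definite_trace[OF \<rho>])
  then show "X ** B s = A s ** E"
    by (simp add: D_def)
qed

subsection \<open>Traces of linear maps on matrices\<close>

definition matrix_unit :: "'m \<Rightarrow> 'n \<Rightarrow> complex^'n^'m"
  where "matrix_unit i j = (\<chi> k l. if k = i \<and> l = j then 1 else 0)"

text \<open>This is the trace of \<open>T\<close> as a linear map, computed in the basis of matrix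
  units.\<close>

definition map_trace :: "(complex^'n^'m \<Rightarrow> complex^'n^'m) \<Rightarrow> complex"
  where "map_trace T = (\<Sum>i\<in>UNIV. \<Sum>j\<in>UNIV. T (matrix_unit i j) $ i $ j)"

lemma matrix_mult_unit_nth:
  "(P ** matrix_unit i j ** Q) $ k $ l = P $ k $ i * Q $ j $ l"
proof -
  have "(P ** matrix_unit i j) $ k $ b = (if b = j then P $ k $ i else 0)" for b
    by (simp add: matrix_matrix_mult_def matrix_unit_def if_distrib[of "\<lambda>x. _ * x"] cong: if_cong)
  then show ?thesis
    by (simp add: matrix_matrix_mult_def[of "P ** _"] if_distrib[of "\<lambda>x. x * _"] cong: if_cong)
qed

lemma tendsto_map_trace:
  assumes "\<And>X. (\<lambda>k. T k X) \<longlonglongrightarrow> S X"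
  shows "(\<lambda>k. map_trace (T k)) \<longlonglongrightarrow> map_trace S"
  unfolding map_trace_def by (intro tendsto_sum tendsto_vec_nth assms)

subsection \<open>Overlaps of matrix product states\<close>

lemma sum_lists_length_Suc:
  "(\<Sum>w | length w = Suc M. f w) = (\<Sum>s\<in>UNIV. \<Sum>w | length w = M. f (s # w))"
  for f :: "'d::finite list \<Rightarrow> 'b::comm_monoid_add"
proof -
  have set: "{w :: 'd list. length w = Suc M} = (\<lambda>(s, w). s # w) ` (UNIV \<times> {w. length w = M})"
    by (auto simp: length_Suc_conv image_iff)
  have "inj_on (\<lambda>(s, w). s # w) (UNIV \<times> {w :: 'd list. length w = M})"
    by (auto simp: inj_on_def)
  then have "(\<Sum>w | length w = Suc M. f w) = (\<Sum>(s, w)\<in>UNIV \<times> {w. length w = M}. f (s # w))"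
    unfolding set by (simp add: sum.reindex case_prod_unfold)
  then show ?thesis
    by (simp add: sum.cartesian_product)
qed

text \<open>Site-dependent tensors: \<open>B i\<close> is the tensor at list position \<open>i\<close>.\<close>

fun word_prod :: "(nat \<Rightarrow> ('d, 'n::finite) mps_tensor) \<Rightarrow> 'd list \<Rightarrow> complex^'n^'n"
  where
    "word_prod B [] = mat 1"
  | "word_prod B (s # w) = B 0 s ** word_prod (\<lambda>i. B (Suc i)) w"

text \<open>Site 0 acts first, so it is innermost, as it is in the adjoint word product to the left
  of \<open>X\<close>.\<close>

fun chain_map :: "('d::finite, 'n::finite) mps_tensor \<Rightarrow> (nat \<Rightarrow> ('d, 'n) mps_tensor) \<Rightarrow> nat
    \<Rightarrow> complex^'n^'n \<Rightarrow> complex^'n^'n"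
  where
    "chain_map A B 0 X = X"
  | "chain_map A B (Suc M) X = mixed_channel A (B M) (chain_map A B M X)"

lemma word_prod_const: "word_prod (\<lambda>_. A) w = foldr (**) (map A w) (mat 1)"
  by (induction w) auto

lemma clinear_chain_map: "clinear (chain_map A B M)"
proof (induction M)
  case (Suc M)
  show ?case
    using clinear_add[OF Suc] clinear_cscale[OF Suc] clinear_add[OF clinear_mixed_channel]
      clinear_cscale[OF clinear_mixed_channel]
    by (intro clinearI) auto
qed (simp add: clinearI)

lemma chain_map_add: "chain_map A B (M + N) X = chain_map A (\<lambda>i. B (M + i)) N (chain_map A B M X)"
  by (induction N) auto

lemma chain_map_Suc_front:
  "chain_map A B (Suc M) X = chain_map A (\<lambda>i. B (Suc i)) M (mixed_channel A (B 0) X)"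
  using chain_map_add[of A B 1 M X] by simp

lemma chain_map_periodic:
  assumes "\<And>i. B (L + i) = B i"
  shows "chain_map A B (k * L) = chain_map A B L ^^ k"
  by (induction k) (auto simp: fun_eq_iff chain_map_add assms funpow_swap1)

lemma chain_map_const: "chain_map A (\<lambda>_. B) M = mixed_channel A B ^^ M"
  by (induction M) auto

text \<open>Words grow at the front while \<open>chain_map\<close> recurses at the back, so the
  induction peels off site 0 by \<open>chain_map_Suc_front\<close>.\<close>

lemma chain_map_eq_sum_words:
  "chain_map A B M X = (\<Sum>w | length w = M. (word_prod (\<lambda>_. A) w)\<^sup>\<dagger> ** X ** word_prod B w)"
proof (induction M arbitrary: B X)
  case (Suc M)
  have "chain_map A B (Suc M) X
    = (\<Sum>w | length w = M. \<Sum>s\<in>UNIV.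
        (word_prod (\<lambda>_. A) w)\<^sup>\<dagger> ** ((A s)\<^sup>\<dagger> ** X ** B 0 s) ** word_prod (\<lambda>i. B (Suc i)) w)"
    unfolding chain_map_Suc_front Suc.IH mixed_channel_def
    by (simp add: matrix_mult_sum_left matrix_mult_sum_right)
  also have "\<dots> = (\<Sum>s\<in>UNIV. \<Sum>w | length w = M.
        (word_prod (\<lambda>_. A) (s # w))\<^sup>\<dagger> ** X ** word_prod B (s # w))"
    by (subst sum.swap) (simp add: cadjoint_mult matrix_mul_assoc)
  finally show ?case
    by (simp only: sum_lists_length_Suc)
qed simp

text \<open>A map sending \<open>X\<close> to \<open>P\<^sup>\<dagger> ** X ** Q\<close> has trace
  \<open>cnj (trace P) * trace Q\<close>; the chain map is a sum of such maps over words.\<close>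

lemma map_trace_chain_map:
  "map_trace (chain_map A B M)
    = (\<Sum>w | length w = M. cnj (trace (word_prod (\<lambda>_. A) w)) * trace (word_prod B w))"
proof -
  have "map_trace (chain_map A B M)
    = (\<Sum>i\<in>UNIV. \<Sum>j\<in>UNIV. \<Sum>w | length w = M.
        cnj (word_prod (\<lambda>_. A) w $ i $ i) * word_prod B w $ j $ j)"
    by (simp add: map_trace_def chain_map_eq_sum_words matrix_mult_unit_nth)
  also have "\<dots> = (\<Sum>i\<in>UNIV. \<Sum>w | length w = M. \<Sum>j\<in>UNIV.
        cnj (word_prod (\<lambda>_. A) w $ i $ i) * word_prod B w $ j $ j)"
    by (intro sum.cong refl sum.swap)
  also have "\<dots> = (\<Sum>w | length w = M. \<Sum>i\<in>UNIV. \<Sum>j\<in>UNIV.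
        cnj (word_prod (\<lambda>_. A) w $ i $ i) * word_prod B w $ j $ j)"
    by (rule sum.swap)
  finally show ?thesis
    by (simp add: trace_def sum_product)
qed

text \<open>This is multilinear expansion in the physical indices. After taking traces it shows that
  local operators turn the state of \<open>A\<close> into one with site-dependent tensors.\<close>

lemma word_prod_act:
  "word_prod (\<lambda>i. act (U i) A) w
    = (\<Sum>t | length t = length w. (\<Prod>i<length w. U i $ (w ! i) $ (t ! i)) *\<^sub>C word_prod (\<lambda>_. A) t)"
proof (induction w arbitrary: U)
  case (Cons s w)
  have "word_prod (\<lambda>i. act (U i) A) (s # w)
    = (\<Sum>a\<in>UNIV. \<Sum>t | length t = length w.
        (U 0 $ s $ a * (\<Prod>i<length w. U (Suc i) $ (w ! i) $ (t ! i))) *\<^sub>C (A a ** word_prod (\<lambda>_. A) t))"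
    unfolding word_prod.simps Cons.IH[of "\<lambda>i. U (Suc i)"]
    by (simp add: act_def matrix_mult_sum_left matrix_mult_sum_right
        matrix_mult_cscale_left matrix_mult_cscale_right cscale_sum_right)
      (subst sum.swap, simp add: mult.commute)
  then show ?case
    by (simp add: sum_lists_length_Suc prod.lessThan_Suc_shift del: prod.lessThan_Suc)
qed simp

text \<open>Site \<open>j\<close> of block \<open>b\<close> is list position
  \<open>b * L + j\<close>, whose residue mod \<open>L\<close> is \<open>j\<close>;
  \<open>Suc\<close> appears because the family \<open>U\<close> is numbered from 1.\<close>

lemma tensor_power_site_tensor:
  assumes s: "length s = k * L" and t: "length t = k * L"
  shows "tensor_power L (site_tensor U L) k s t
    = (\<Prod>i<k * L. U (Suc (i mod L)) $ (s ! i) $ (t ! i))"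
proof -
  have "tensor_power L (site_tensor U L) k s t
    = (\<Prod>b<k. \<Prod>j<L. U (Suc j) $ (s ! (b * L + j)) $ (t ! (b * L + j)))"
    unfolding tensor_power_def site_tensor_def
  proof (rule prod.cong[OF refl], rule prod.cong[OF refl])
    fix b j assume "b \<in> {..<k}" "j \<in> {..<L}"
    moreover from this have "b * L \<le> length s" "b * L \<le> length t"
      using s t by auto
    ultimately show "U (Suc j) $ (take L (drop (b * L) s) ! j) $ (take L (drop (b * L) t) ! j)
      = U (Suc j) $ (s ! (b * L + j)) $ (t ! (b * L + j))"
      by simp
  qed
  also have "\<dots> = (\<Prod>b<k. \<Prod>i\<in>{b * L..<b * L + L}. U (Suc (i mod L)) $ (s ! i) $ (t ! i))"
  proof (rule prod.cong[OF refl])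
    fix b
    show "(\<Prod>j<L. U (Suc j) $ (s ! (b * L + j)) $ (t ! (b * L + j)))
      = (\<Prod>i\<in>{b * L..<b * L + L}. U (Suc (i mod L)) $ (s ! i) $ (t ! i))"
      by (rule prod.reindex_bij_witness[of _ "\<lambda>i. i - b * L" "\<lambda>j. b * L + j"]) auto
  qed
  also have "\<dots> = (\<Prod>i<k * L. U (Suc (i mod L)) $ (s ! i) $ (t ! i))"
    by (rule prod.nat_group)
  finally show ?thesis .
qed

text \<open>This converts the eigenstate assumption into a statement about the trace of a linear
  map.\<close>

lemma mps_overlap:
  fixes A :: "('d::finite, 'n::finite) mps_tensor"
  shows "(\<Sum>w | length w = k * L. cnj (mps A (k * L) w)
      * apply_op (k * L) (tensor_power L (site_tensor U L) k) (mps A (k * L)) w)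
    = map_trace (chain_map A (\<lambda>i. act (U (Suc (i mod L))) A) (k * L))"
  unfolding map_trace_chain_map
proof (intro sum.cong refl)
  fix w :: "'d list" assume "w \<in> {w. length w = k * L}"
  then have w: "length w = k * L" by simp
  have "apply_op (k * L) (tensor_power L (site_tensor U L) k) (mps A (k * L)) w
    = (\<Sum>t | length t = k * L. (\<Prod>i<k * L. U (Suc (i mod L)) $ (w ! i) $ (t ! i))
        * trace (word_prod (\<lambda>_. A) t))"
    unfolding apply_op_def mps_def word_prod_const using w
    by (simp add: tensor_power_site_tensor)
  also have "\<dots> = trace (word_prod (\<lambda>i. act (U (Suc (i mod L))) A) w)"
    by (simp add: word_prod_act w trace_sum trace_cscale)
  finally show "cnj (mps A (k * L) w)
      * apply_op (k * L) (tensor_power L (site_tensor U L) k) (mps A (k * L)) w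
    = cnj (trace (word_prod (\<lambda>_. A) w)) * trace (word_prod (\<lambda>i. act (U (Suc (i mod L))) A) w)"
    using w by (simp add: mps_def word_prod_const)
qed

lemma mps_norm_square:
  "(\<Sum>w | length w = M. cnj (mps A M w) * mps A M w) = map_trace (mixed_channel A A ^^ M)"
  unfolding chain_map_const[symmetric] map_trace_chain_map
  by (intro sum.cong refl) (simp add: mps_def word_prod_const)

subsection \<open>Convergence of the transfer channel\<close>

text \<open>Eigenvectors lie in the generalized eigenspace (exponent 1), which is contained in the
  span of a single matrix.\<close>

lemma simple_eigenvalue_eigenvectors:
  assumes "simple_eigenvalue T c" and X: "T X = c *\<^sub>C X" and Y: "T Y = c *\<^sub>C Y" "Y \<noteq> 0"
  shows "\<exists>a. X = a *\<^sub>C Y"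
proof -
  interpret cmat: vector_space "cscale :: complex \<Rightarrow> complex^'a^'a \<Rightarrow> complex^'a^'a"
    by (rule vector_space_cscale)
  obtain S where S: "generalized_eigenspace T c \<subseteq> cmat.span S" "card S = 1"
    using assms(1) unfolding simple_eigenvalue_def
    by (metis cmat.basis_exists[of "generalized_eigenspace T c"])
  then obtain b where "S = {b}"
    by (auto simp: card_1_singleton_iff)
  moreover have "X \<in> generalized_eigenspace T c" "Y \<in> generalized_eigenspace T c"
    using X Y by (auto simp: generalized_eigenspace_def intro!: exI[of _ 1])
  ultimately obtain x y where xy: "X = x *\<^sub>C b" "Y = y *\<^sub>C b"
    using S unfolding \<open>S = {b}\<close> cmat.span_singleton by blast
  then have "X = (x / y) *\<^sub>C Y"
    using Y by (cases "y = 0") auto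
  then show ?thesis ..
qed

text \<open>Subtracting the rank-one map \<open>trace (Y ** \<rho>) *\<^sub>C mat 1\<close> removes
  the eigenvalue 1 and leaves a map \<open>T\<close> with all eigenvalues of modulus below
  1.\<close>

lemma transfer_powers_tendsto:
  fixes A :: "('d::finite, 'n::finite) mps_tensor"
  assumes A: "left_canonical_injective A"
    and \<rho>: "(\<Sum>s\<in>UNIV. A s ** \<rho> ** (A s)\<^sup>\<dagger>) = \<rho>" "trace \<rho> = 1"
  shows "(\<lambda>k. (mixed_channel A A ^^ k) X) \<longlonglongrightarrow> trace (X ** \<rho>) *\<^sub>C mat 1"
proof -
  define E where "E = mixed_channel A A"
  define T where "T Y = E Y - trace (Y ** \<rho>) *\<^sub>C mat 1" for Y
  note E = clinear_mixed_channel[of A A, folded E_def]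
  have E_1: "E (mat 1) = mat 1" and simple: "simple_eigenvalue E 1"
    and gap: "\<And>c. is_eigenvalue E c \<Longrightarrow> c \<noteq> 1 \<Longrightarrow> cmod c < 1"
    using A by (auto simp: left_canonical_injective_def transfer_channel_eq_mixed E_def)
  have "(mat 1 :: complex^'n^'n) $ i $ i \<noteq> 0" for i
    by (simp add: mat_def)
  then have mat_1: "(mat 1 :: complex^'n^'n) \<noteq> 0"
    by (metis zero_index)
  have trace_E: "trace (E Y ** \<rho>) = trace (Y ** \<rho>)" for Y
  proof -
    have "trace (E Y ** \<rho>) = (\<Sum>s\<in>UNIV. trace ((A s)\<^sup>\<dagger> ** (Y ** A s ** \<rho>)))"
      by (simp add: E_def mixed_channel_def matrix_mult_sum_left trace_sum matrix_mul_assoc)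
    also have "\<dots> = (\<Sum>s\<in>UNIV. trace (Y ** (A s ** \<rho> ** (A s)\<^sup>\<dagger>)))"
      by (subst trace_mul_sym) (simp add: matrix_mul_assoc)
    also have "\<dots> = trace (Y ** (\<Sum>s\<in>UNIV. A s ** \<rho> ** (A s)\<^sup>\<dagger>))"
      by (simp add: matrix_mult_sum_right trace_sum)
    finally show ?thesis
      by (simp add: \<rho>)
  qed
  have trace_T: "trace (T Y ** \<rho>) = 0" for Y
    by (simp add: T_def matrix_mult_diff_left trace_sub trace_E matrix_mult_cscale_left trace_cscale \<rho>)
  have T: "clinear T"
    by (rule clinearI) (simp_all add: T_def clinear_add[OF E] clinear_cscale[OF E] matrix_mult_add_left
        matrix_mult_cscale_left trace_add trace_cscale vec_eq_iff algebra_simps)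
  have "cmod c < 1" if ev: "is_eigenvalue T c" for c
  proof -
    obtain Y where Y: "Y \<noteq> 0" "T Y = c *\<^sub>C Y"
      using ev by (auto simp: is_eigenvalue_def)
    \<comment> \<open>The range of \<open>T\<close> lies in the kernel of the functional
      \<open>trace (Y ** \<rho>)\<close>. An eigenvector for nonzero \<open>c\<close> thus lies
      where \<open>T\<close> and \<open>E\<close> agree, and \<open>c = 1\<close> would make it a
      multiple of the identity, on which the functional is nonzero unless the multiple is 0.\<close>
    have *: "c * trace (Y ** \<rho>) = 0"
      using trace_T[of Y] by (simp add: Y matrix_mult_cscale_left trace_cscale)
    show ?thesis
    proof (cases "c = 0")
      case False
      with * have tr: "trace (Y ** \<rho>) = 0" by simp
      then have EY: "E Y = c *\<^sub>C Y"
        using Y by (simp add: T_def)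
      have "c \<noteq> 1"
      proof
        assume "c = 1"
        then obtain a where "Y = a *\<^sub>C mat 1"
          using simple_eigenvalue_eigenvectors[OF simple, of Y "mat 1"] EY E_1
          using mat_1 by auto
        then show False
          using tr Y by (simp add: matrix_mult_cscale_left trace_cscale \<rho>)
      qed
      then show ?thesis
        using gap[of c] EY Y by (auto simp: is_eigenvalue_def)
    qed simp
  qed
  then have lim: "(\<lambda>k. (T ^^ k) X) \<longlonglongrightarrow> 0"
    by (rule funpow_tendsto_0[OF T])
  \<comment> \<open>The exponent starts at 1: at exponent 0 both powers are \<open>X\<close>,
    without the rank-one term.\<close>
  have "(E ^^ Suc k) X = (T ^^ Suc k) X + trace (X ** \<rho>) *\<^sub>C mat 1" for k
  proof (induction k)
    case 0
    show ?case by (simp add: T_def)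
  next
    case (Suc k)
    have "(T ^^ Suc (Suc k)) X = E ((T ^^ Suc k) X)"
      using trace_T[of "(T ^^ k) X"] by (simp add: T_def[of "T _"])
    then show ?case
      using Suc clinear_add[OF E] clinear_cscale[OF E] by (simp add: E_1)
  qed
  then have "(\<lambda>k. (E ^^ Suc k) X) \<longlonglongrightarrow> 0 + trace (X ** \<rho>) *\<^sub>C mat 1"
    using LIMSEQ_Suc[OF lim] by (simp only: tendsto_add tendsto_const)
  then show ?thesis
    unfolding E_def[symmetric] add_0_left by (rule LIMSEQ_imp_Suc)
qed

text \<open>The limit map has rank one and trace \<open>trace \<rho> = 1\<close>; by
  \<open>mps_norm_square\<close> the squared norms of the states tend to 1.\<close>

lemma map_trace_transfer_powers_tendsto:
  fixes A :: "('d::finite, 'n::finite) mps_tensor"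
  assumes "left_canonical_injective A"
    and "(\<Sum>s\<in>UNIV. A s ** \<rho> ** (A s)\<^sup>\<dagger>) = \<rho>" "trace \<rho> = 1"
  shows "(\<lambda>k. map_trace (mixed_channel A A ^^ k)) \<longlonglongrightarrow> 1"
proof -
  have tr: "trace (matrix_unit i j ** \<rho>) = \<rho> $ j $ i" for i j
  proof -
    have "(matrix_unit i j ** \<rho>) $ k $ k = (if k = i then \<rho> $ j $ k else 0)" for k
    proof -
      have "mat 1 $ k $ i = (if k = i then 1 else 0 :: complex)"
        by (simp add: mat_def)
      then show ?thesis
        using matrix_mult_unit_nth[of "mat 1" i j \<rho> k k] by simp
    qed
    then show ?thesis by (simp add: trace_def)
  qed
  have "map_trace (\<lambda>X. trace (X ** \<rho>) *\<^sub>C mat 1) = trace \<rho>"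
    unfolding trace_def[of \<rho>] by (simp add: map_trace_def tr mat_def if_distrib[of "\<lambda>x. _ * x"] cong: if_cong)
  then show ?thesis
    using tendsto_map_trace[of "\<lambda>k. mixed_channel A A ^^ k", OF transfer_powers_tendsto[OF assms]] assms(3)
    by simp
qed

subsection \<open>Local symmetries of the tensor\<close>

theorem mainTheorem1:
  fixes A :: "('d::finite, 'n::finite) mps_tensor"
    and U :: "nat \<Rightarrow> complex^'d^'d"
    and L :: nat
  assumes "left_canonical_injective A"
    and "L \<ge> 1"
    and "\<forall>j\<in>{1..L}. unitary (U j)"
    and "\<forall>k\<ge>1. \<exists>\<theta>::real. apply_op (k * L) (tensor_power L (site_tensor U L) k) (mps A (k * L))
           = (\<lambda>s. exp (\<i> * of_real \<theta>) * mps A (k * L) s)"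
  shows "\<exists>v :: nat \<Rightarrow> complex^'n^'n.
           (\<forall>j\<in>{0..L}. unitary (v j)) \<and> v 0 \<doteq> v L \<and>
           (\<forall>j\<in>{1..L}. \<exists>\<phi>::real. \<forall>s.
              act (U j) A s = exp (\<i> * of_real \<phi>) *\<^sub>C ((v (j - 1))\<^sup>\<dagger> ** A s ** v j))"
proof -
  define E where "E = mixed_channel A A"
  \<comment> \<open>Positions count from 0 and repeat with period \<open>L\<close>, so
    \<open>B i\<close> carries the unitary with index \<open>i mod L + 1\<close>.\<close>
  define B where "B i = act (U (Suc (i mod L))) A" for i
  define F where "F = chain_map A B L"
  obtain \<rho> where \<rho>: "positive_definite \<rho>" "(\<Sum>s\<in>UNIV. A s ** \<rho> ** (A s)\<^sup>\<dagger>) = \<rho>" "trace \<rho> = 1"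
    using assms(1) by (auto simp: left_canonical_injective_def)
  have A_iso: "(\<Sum>s\<in>UNIV. (A s)\<^sup>\<dagger> ** A s) = mat 1"
    using assms(1) by (simp add: left_canonical_injective_def transfer_channel_def)
  have U: "unitary (U (Suc (i mod L)))" for i
    using assms(2,3) by (simp add: Suc_leI)
  have B_\<rho>: "(\<Sum>s\<in>UNIV. B i s ** \<rho> ** (B i s)\<^sup>\<dagger>) = \<rho>" for i
    unfolding B_def sum_act_conjugate[OF U] by (rule \<rho>)
  have F_pow: "chain_map A B (k * L) = F ^^ k" for k
    unfolding F_def by (rule chain_map_periodic) (simp add: B_def)

  \<comment> \<open>An eigenvalue of \<open>F\<close> of modulus at least 1\<close>
  have norm_eq: "cmod (map_trace (F ^^ k)) = cmod (map_trace (E ^^ (k * L)))" if k: "k \<ge> 1" for k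
  proof -
    obtain \<theta> where \<theta>: "apply_op (k * L) (tensor_power L (site_tensor U L) k) (mps A (k * L))
        = (\<lambda>s. exp (\<i> * of_real \<theta>) * mps A (k * L) s)"
      using assms(4) k by blast
    have "map_trace (F ^^ k) = (\<Sum>w | length w = k * L. cnj (mps A (k * L) w)
        * apply_op (k * L) (tensor_power L (site_tensor U L) k) (mps A (k * L)) w)"
      by (simp only: F_pow[symmetric] B_def[abs_def] mps_overlap)
    also have "\<dots> = (\<Sum>w | length w = k * L.
        exp (\<i> * of_real \<theta>) * (cnj (mps A (k * L) w) * mps A (k * L) w))"
      by (simp only: \<theta> mult.left_commute)
    also have "\<dots> = exp (\<i> * of_real \<theta>) * map_trace (E ^^ (k * L))"
      by (simp only: sum_distrib_left[symmetric] mps_norm_square E_def)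
    finally have "map_trace (F ^^ k) = exp (\<i> * of_real \<theta>) * map_trace (E ^^ (k * L))" .
    then show ?thesis
      by (simp add: norm_mult)
  qed
  obtain c X where c: "cmod c \<ge> 1" and X: "X \<noteq> 0" "F X = c *\<^sub>C X"
  proof -
    have "\<exists>c. is_eigenvalue F c \<and> cmod c \<ge> 1"
    proof (rule ccontr)
      assume "\<nexists>c. is_eigenvalue F c \<and> cmod c \<ge> 1"
      then have "(\<lambda>k. (F ^^ k) X) \<longlonglongrightarrow> 0" for X
        by (intro funpow_tendsto_0) (auto simp: F_def clinear_chain_map not_le)
      then have "(\<lambda>k. map_trace (F ^^ k)) \<longlonglongrightarrow> 0"
        using tendsto_map_trace[of "\<lambda>k. F ^^ k" "\<lambda>_. 0"] by (simp add: map_trace_def)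
      then have "(\<lambda>k. cmod (map_trace (F ^^ k))) \<longlonglongrightarrow> 0"
        by (rule tendsto_norm_zero)
      moreover have "\<forall>\<^sub>F k in sequentially. cmod (map_trace (F ^^ k)) = cmod (map_trace (E ^^ (k * L)))"
        using eventually_ge_at_top[of 1] by eventually_elim (rule norm_eq)
      ultimately have "(\<lambda>k. cmod (map_trace (E ^^ (k * L)))) \<longlonglongrightarrow> 0"
        by (rule Lim_transform_eventually)
      \<comment> \<open>Positivity of \<open>L\<close> makes the lengths \<open>k * L\<close> a
        genuine subsequence, along which the squared norms still tend to 1.\<close>
      moreover have "strict_mono (\<lambda>k. k * L)"
        using assms(2) by (auto simp: strict_mono_def)
      then have "(\<lambda>k. cmod (map_trace (E ^^ (k * L)))) \<longlonglongrightarrow> cmod 1"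
        using LIMSEQ_subseq_LIMSEQ[OF tendsto_norm[OF map_trace_transfer_powers_tendsto[OF assms(1) \<rho>(2,3)]]]
        by (force simp: o_def E_def)
      ultimately show False
        using LIMSEQ_unique by fastforce
    qed
    then show thesis
      using that by (auto simp: is_eigenvalue_def)
  qed

  \<comment> \<open>Rigidity of the orbit of \<open>X\<close> in the weighted norm\<close>
  define Y where "Y j = chain_map A B j X" for j
  have Y_0: "Y 0 = X" and Y_L: "Y L = c *\<^sub>C X"
    using X by (simp_all add: Y_def F_def)
  define g where "g Z = Re (trace (Z ** \<rho> ** Z\<^sup>\<dagger>))" for Z :: "complex^'n^'n"
  have g_step: "g (Y (Suc j)) \<le> g (Y j)" for j
    unfolding g_def Y_def by (simp add: mixed_channel_contraction[OF A_iso B_\<rho> \<rho>(1)])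
  then have g_anti: "g (Y j) \<le> g (Y i)" if "i \<le> j" for i j
    using that by (rule lift_Suc_antimono_le)
  have g_X: "g X > 0"
    using positive_definite_trace[OF \<rho>(1), of X] X(1) unfolding g_def by linarith
  have g_c: "g (c *\<^sub>C X) = (cmod c)\<^sup>2 * g X"
  proof -
    have "trace ((c *\<^sub>C X) ** \<rho> ** (c *\<^sub>C X)\<^sup>\<dagger>)
      = of_real ((cmod c)\<^sup>2) * trace (X ** \<rho> ** X\<^sup>\<dagger>)"
      unfolding complex_norm_square
      by (simp add: cadjoint_cscale matrix_mult_cscale_left matrix_mult_cscale_right trace_cscale mult_ac)
    then show ?thesis
      unfolding g_def by (simp only: times_complex.simps Re_complex_of_real Im_complex_of_real)
  qed
  \<comment> \<open>Over a full period \<open>g\<close> is multiplied by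
    \<open>(cmod c)\<^sup>2\<close> but cannot grow.\<close>
  have "(cmod c)\<^sup>2 * g X \<le> 1 * g X"
    using g_anti[of 0 L] by (simp add: Y_0 Y_L g_c)
  then have "(cmod c)\<^sup>2 \<le> 1\<^sup>2"
    using g_X by simp
  then have c_1: "cmod c = 1"
    using c power2_le_imp_le[of "cmod c" 1] by simp
  have c_cnj: "cnj c * c = 1" "c * cnj c = 1"
    using c_1 complex_norm_square[of c] by (simp_all add: mult.commute)
  \<comment> \<open>\<open>g\<close> is nonincreasing and returns to its initial value after
    \<open>L\<close> steps, so every step is an equality case of the contraction.\<close>
  have intertwine: "Y j ** B j s = A s ** Y (Suc j)" if "j < L" for j s
  proof -
    have "g (Y L) = g X"
      by (simp add: Y_L g_c c_1)
    then have "g (Y (Suc j)) = g (Y j)"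
      using g_anti[of "Suc j" L] g_anti[of 0 j] g_step[of j] that by (simp add: Y_0)
    then show ?thesis
      unfolding g_def Y_def chain_map.simps
      by (rule mixed_channel_contraction_eq[OF A_iso B_\<rho> \<rho>(1)])
  qed

  \<comment> \<open>Gram matrices of the orbit\<close>
  have gram_step: "E ((Y j)\<^sup>\<dagger> ** Y j) = (Y (Suc j))\<^sup>\<dagger> ** Y (Suc j)" if "j < L" for j
  proof -
    have "E ((Y j)\<^sup>\<dagger> ** Y j) = mixed_channel (B j) (B j) ((Y j)\<^sup>\<dagger> ** Y j)"
      by (simp add: E_def B_def mixed_channel_act[OF U])
    also have "\<dots> = (\<Sum>s\<in>UNIV. (Y j ** B j s)\<^sup>\<dagger> ** (Y j ** B j s))"
      by (simp add: mixed_channel_def cadjoint_mult matrix_mul_assoc)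
    also have "\<dots> = (\<Sum>s\<in>UNIV. (Y (Suc j))\<^sup>\<dagger> ** ((A s)\<^sup>\<dagger> ** A s) ** Y (Suc j))"
      by (simp add: intertwine[OF that] cadjoint_mult matrix_mul_assoc)
    finally show ?thesis
      by (simp add: A_iso flip: matrix_mult_sum_left matrix_mult_sum_right)
  qed
  have gram: "(Y j)\<^sup>\<dagger> ** Y j = (E ^^ j) (X\<^sup>\<dagger> ** X)" if "j \<le> L" for j
    using that by (induction j) (simp_all add: Y_0 flip: gram_step)
  have "(E ^^ L) (X\<^sup>\<dagger> ** X) = X\<^sup>\<dagger> ** X"
    using gram[of L] by (simp add: Y_L cadjoint_cscale matrix_mult_cscale_left matrix_mult_cscale_right c_cnj)
  \<comment> \<open>The phase of \<open>c\<close> cancels in the Gram matrix. The sequence of its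
    images under \<open>E ^^ (k * L)\<close> is therefore constant and equals its limit, a multiple
    of the identity.\<close>
  then have fixed: "(E ^^ (k * L)) (X\<^sup>\<dagger> ** X) = X\<^sup>\<dagger> ** X" for k
    by (induction k) (simp_all add: funpow_add)
  define z where "z = trace (X\<^sup>\<dagger> ** X ** \<rho>)"
  have "strict_mono (\<lambda>k. k * L)"
    using assms(2) by (auto simp: strict_mono_def)
  then have "(\<lambda>k. (E ^^ (k * L)) (X\<^sup>\<dagger> ** X)) \<longlonglongrightarrow> z *\<^sub>C mat 1"
    using LIMSEQ_subseq_LIMSEQ[OF transfer_powers_tendsto[OF assms(1) \<rho>(2,3)]]
    by (force simp: o_def E_def z_def)
  then have gram_X: "X\<^sup>\<dagger> ** X = z *\<^sub>C mat 1"
    by (simp add: fixed LIMSEQ_const_iff)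
  have E_1: "E (mat 1) = mat 1"
    using A_iso by (simp add: E_def mixed_channel_def)
  have gram_Y: "(Y j)\<^sup>\<dagger> ** Y j = z *\<^sub>C mat 1" if "j \<le> L" for j
  proof -
    have "(E ^^ j) (z *\<^sub>C mat 1) = z *\<^sub>C mat 1"
      by (induction j) (simp_all add: E_1 clinear_cscale[OF clinear_mixed_channel[of A A, folded E_def]])
    then show ?thesis
      using gram[OF that] by (simp add: gram_X)
  qed
  obtain r where r: "r > 0" "z = of_real r"
  proof -
    \<comment> \<open>A column of \<open>X\<close> with a nonzero entry shows that \<open>z\<close>,
      a diagonal entry of the Gram matrix, is real and positive.\<close>
    obtain k i where ki: "X $ k $ i \<noteq> 0"
      using X(1) by (auto simp: vec_eq_iff)
    have "z = (X\<^sup>\<dagger> ** X) $ i $ i"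
      by (simp add: gram_X mat_def)
    also have "\<dots> = of_real (\<Sum>l\<in>UNIV. (cmod (X $ l $ i))\<^sup>2)"
      unfolding of_real_sum complex_norm_square by (simp add: matrix_matrix_mult_def mult.commute)
    finally have "z = of_real (\<Sum>l\<in>UNIV. (cmod (X $ l $ i))\<^sup>2)" .
    moreover have "(\<Sum>l\<in>UNIV. (cmod (X $ l $ i))\<^sup>2) > 0"
      using ki by (intro sum_pos2[of UNIV k]) auto
    ultimately show thesis
      by (rule that[rotated])
  qed

  \<comment> \<open>Rescaling to unitaries\<close>
  define v where "v j = of_real (1 / sqrt r) *\<^sub>C Y j" for j
  have scale: "complex_of_real (1 / sqrt r) * of_real (1 / sqrt r) * z = 1"
    using r by (simp flip: of_real_mult)
  have v_gram: "(v j)\<^sup>\<dagger> ** v j = mat 1" if "j \<le> L" for j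
    using scale by (simp add: v_def cadjoint_cscale matrix_mult_cscale_left matrix_mult_cscale_right
        gram_Y[OF that] mult.assoc)
  show ?thesis
  proof (intro exI[of _ v] conjI ballI)
    fix j assume "j \<in> {0..L}"
    then show "unitary (v j)"
      using v_gram[of j] matrix_left_right_inverse[of "(v j)\<^sup>\<dagger>" "v j"] by (simp add: unitary_def)
  next
    \<comment> \<open>\<open>Y L\<close> is \<open>c *\<^sub>C X\<close>, and \<open>cnj c\<close>
      inverts \<open>c\<close> because its modulus is 1.\<close>
    have "v 0 = cnj c *\<^sub>C v L"
      by (simp add: v_def Y_0 Y_L mult.left_commute c_cnj)
    then show "v 0 \<doteq> v L"
      using c_1 by (auto simp: eq_upto_phase_def intro!: exI[of _ "cnj c"])
  next
    fix j assume j: "j \<in> {1..L}"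
    then have j': "j - 1 < L" "Suc (j - 1) = j" by auto
    have "(v (j - 1))\<^sup>\<dagger> ** A s ** v j = act (U j) A s" for s
    proof -
      have "A s ** v j = v (j - 1) ** B (j - 1) s"
        using intertwine[OF j'(1), of s] j'(2)
        by (simp add: v_def matrix_mult_cscale_left matrix_mult_cscale_right)
      then have "(v (j - 1))\<^sup>\<dagger> ** A s ** v j = (v (j - 1))\<^sup>\<dagger> ** v (j - 1) ** B (j - 1) s"
        by (metis matrix_mul_assoc)
      also have "\<dots> = act (U j) A s"
        using v_gram[of "j - 1"] j' by (simp add: B_def)
      finally show ?thesis .
    qed
    \<comment> \<open>The local phases can be taken trivial: the matrices \<open>v j\<close> absorb
      them, and only the mismatch \<open>c\<close> between \<open>v 0\<close> and \<open>v L\<close>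
      remains.\<close>
    then show "\<exists>\<phi>::real. \<forall>s. act (U j) A s = exp (\<i> * of_real \<phi>) *\<^sub>C ((v (j - 1))\<^sup>\<dagger> ** A s ** v j)"
      by (intro exI[of _ 0]) simp
  qed
qed

end
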